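(* Let $\phi:\mathbb{R}^M\times\mathbb{R}^M\to\mathbb{R}$ be a nonnegative symmetric kernel function, let $\xi_1,\dots,\xi_N\in\mathbb{R}^M$, and let $\mathbf{K}\in\mathbb{R}^{N\times N}$, $\mathbf{K}_{i,j}=\phi(\xi_i,\xi_j)$, and $\mathbf{D}\in\mathbb{R}^{N\times N}$ be the diagonal matrix with $\mathbf{D}_{i,i}=\sum_{j=1}^N\mathbf{K}_{i,j}$, where $\mathbf{D}_{i,i}>0$ for all $i$. If $\phi$ is positive definite and $D(x)=\mathbf{D}^{-1}\mathbf{K}x$ for $x\in\mathbb{R}^N$, then $D$ belongs to $\mathcal{L}$, i.e., the matrix $\mathbf{D}^{-1}\mathbf{K}$ is diagonalizable and its eigenvalues are in $[0,1]$. Furthermore, $D$ is $\theta$-averaged on $(\mathbb{R}^N,\langle\cdot,\cdot\rangle)$ for every $\theta\in[1/2,1)$, where $$\langle x,y\rangle=x^\top\mathbf{D}\,y.$$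
   Context: Positive definite kernel: $\phi:\mathbb{R}^M\times\mathbb{R}^M\to\mathbb{R}$ is called positive definite if for any $N\ge1$, $c_1,\dots,c_N\in\mathbb{R}$ and $x_1,\dots,x_N\in\mathbb{R}^M$, $\sum_{i=1}^N\sum_{j=1}^N c_ic_j\phi(x_i,x_j)\ge0$ (non-strict inequality). $\mathcal{L}$ denotes the class of linear operators $D(x)=\mathbf{W}x$ such that $\mathbf{W}$ is (real) diagonalizable and its eigenvalues are in $[0,1]$. Averaged: on $(\mathbb{R}^N,\langle\cdot,\cdot\rangle)$ with induced norm $\|\cdot\|$, $A$ is $\theta$-averaged, $\theta\in(0,1)$, if $A=(1-\theta)I+\theta T$, where $I$ is the identity and $\|T(x)-T(y)\|\le\|x-y\|$ for all $x,y$. The vectors $\xi_i$ are the features attached to the $N$ pixels of an image, and $D$ is the kernel filter $(D(x))_i=\sum_j\phi(\xi_i,\xi_j)x_j\big/\sum_j\phi(\xi_i,\xi_j)$. *)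

theory Defs
  imports "HOL-Analysis.Analysis"
begin

text \<open>The number of points \<open>N\<close> is quantified inside the definition, so the points are
  indexed by natural numbers below \<open>N\<close>. They need not be distinct, and the inequality
  is non-strict.\<close>

definition positive_definite_kernel :: "('a \<Rightarrow> 'a \<Rightarrow> real) \<Rightarrow> bool" where
  "positive_definite_kernel \<phi> \<longleftrightarrow>
     (\<forall>N\<ge>1. \<forall>(c :: nat \<Rightarrow> real) (x :: nat \<Rightarrow> 'a).
        (\<Sum>i<N. \<Sum>j<N. c i * c j * \<phi> (x i) (x j)) \<ge> 0)"

definition kernel_matrix :: "('a \<Rightarrow> 'a \<Rightarrow> real) \<Rightarrow> ('n \<Rightarrow> 'a) \<Rightarrow> real ^ 'n ^ 'n" where
  "kernel_matrix \<phi> \<xi> = (\<chi> i j. \<phi> (\<xi> i) (\<xi> j))"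

definition row_sum_matrix :: "real ^ 'n ^ 'n \<Rightarrow> real ^ 'n ^ 'n" where
  "row_sum_matrix K = (\<chi> i j. if i = j then (\<Sum>k\<in>UNIV. K $ i $ k) else 0)"

definition diagonal_matrix :: "real ^ 'n ^ 'n \<Rightarrow> bool" where
  "diagonal_matrix A \<longleftrightarrow> (\<forall>i j. i \<noteq> j \<longrightarrow> A $ i $ j = 0)"

definition diagonalizable :: "real ^ 'n ^ 'n \<Rightarrow> bool" where
  "diagonalizable A \<longleftrightarrow>
     (\<exists>P \<Lambda> :: real ^ 'n ^ 'n. invertible P \<and> diagonal_matrix \<Lambda> \<and>
        A = P ** \<Lambda> ** matrix_inv P)"

text \<open>Only real eigenvalues are considered. This notion is used together with
  diagonalizability over the reals, in which case every complex eigenvalue is real.\<close>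

definition eigenvalue :: "real ^ 'n ^ 'n \<Rightarrow> real \<Rightarrow> bool" where
  "eigenvalue A l \<longleftrightarrow> (\<exists>v. v \<noteq> 0 \<and> A *v v = l *\<^sub>R v)"

definition class_L :: "(real ^ 'n \<Rightarrow> real ^ 'n) set" where
  "class_L = {f. \<exists>W :: real ^ 'n ^ 'n.
     f = (\<lambda>x. W *v x) \<and> diagonalizable W \<and> (\<forall>l. eigenvalue W l \<longrightarrow> l \<in> {0..1})}"

definition is_inner_product :: "('v::real_vector \<Rightarrow> 'v \<Rightarrow> real) \<Rightarrow> bool" where
  "is_inner_product ip \<longleftrightarrow>
     (\<forall>x y. ip x y = ip y x) \<and>
     (\<forall>x y z. ip (x + y) z = ip x z + ip y z) \<and>
     (\<forall>r x y. ip (r *\<^sub>R x) y = r * ip x y) \<and>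
     (\<forall>x. x \<noteq> 0 \<longrightarrow> ip x x > 0)"

definition induced_norm :: "('v::real_vector \<Rightarrow> 'v \<Rightarrow> real) \<Rightarrow> 'v \<Rightarrow> real" where
  "induced_norm ip x = sqrt (ip x x)"

text \<open>The inner product is a parameter, since the notion is used for inner products other
  than the standard one. That \<open>ip\<close> really is an inner product is part of the definition;
  the map \<open>T\<close> is not assumed to be linear.\<close>

definition averaged ::
  "('v::real_vector \<Rightarrow> 'v \<Rightarrow> real) \<Rightarrow> real \<Rightarrow> ('v \<Rightarrow> 'v) \<Rightarrow> bool" where
  "averaged ip \<theta> A \<longleftrightarrow>
     is_inner_product ip \<and> \<theta> \<in> {0<..<1} \<and>
     (\<exists>T. (\<forall>x y. induced_norm ip (T x - T y) \<le> induced_norm ip (x - y)) \<and>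
          (\<forall>x. A x = (1 - \<theta>) *\<^sub>R x + \<theta> *\<^sub>R T x))"

end

theory Submission
  imports Defs
begin

text \<open>Writing \<open>E\<close> for the inverse square root of the diagonal matrix, the filter matrix \<open>E E K\<close> is
  similar, via \<open>E\<close>, to the symmetric matrix \<open>E K E\<close>, which the spectral theorem diagonalizes.
  Positive definiteness and the identity
  \<open>\<Sum>i j. K i j * (v i - v j)^2 = 2 * (v^T Dm v - v^T K v)\<close> place the filter between 0 and the
  identity as a self-adjoint operator for \<open>x^T Dm y\<close>; this bounds the eigenvalues
  and yields averagedness.\<close>

section \<open>Spectral theorem for real symmetric matrices\<close>

text \<open>The quadratic form of \<open>f\<close> attains its maximum on the compact unit sphere of
  \<open>V\<close>, and a maximizer is an eigenvector: otherwise moving along the residual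
  \<open>f v - l v\<close>, which stays in \<open>V\<close> by invariance, would increase the
  Rayleigh quotient.\<close>

lemma self_adjoint_eigenvector_in_subspace:
  fixes f :: "'a::euclidean_space \<Rightarrow> 'a"
  assumes lin: "linear f" and adj: "\<And>x y. f x \<bullet> y = x \<bullet> f y"
    and V: "subspace V" and inv: "f ` V \<subseteq> V" and nz: "V \<noteq> {0}"
  obtains v l where "v \<in> V" "norm v = 1" "f v = l *\<^sub>R v"
proof -
  let ?S = "V \<inter> sphere 0 1"
  obtain u where u: "u \<in> V" "u \<noteq> 0"
    using nz subspace_0[OF V] by blast
  then have "(1 / norm u) *\<^sub>R u \<in> ?S"
    using V by (simp add: subspace_scale)
  then have ne: "?S \<noteq> {}" by blast
  have comp: "compact ?S"
    by (intro closed_Int_compact closed_subspace V compact_sphere)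
  have contf: "continuous_on ?S (\<lambda>x. x \<bullet> f x)"
    by (intro continuous_intros linear_continuous_on linear_conv_bounded_linear[THEN iffD1] lin)
  obtain v where v: "v \<in> ?S" and vmax: "\<And>x. x \<in> ?S \<Longrightarrow> x \<bullet> f x \<le> v \<bullet> f v"
    using continuous_attains_sup[OF comp ne contf] by blast
  define l where "l = v \<bullet> f v"
  have vV: "v \<in> V" and vv: "v \<bullet> v = 1"
    using v by (auto simp: dot_square_norm)
  \<comment> \<open>Homogeneity carries the maximum over unit vectors to all of \<open>V\<close>, so
    perturbations of \<open>v\<close> need not be normalized below.\<close>
  have q: "x \<bullet> f x \<le> l * (x \<bullet> x)" if "x \<in> V" for x
  proof (cases "x = 0")
    case False
    then have "(1 / norm x) *\<^sub>R x \<in> ?S"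
      using that V by (simp add: subspace_scale)
    from vmax[OF this] have "(x \<bullet> f x) / (norm x)\<^sup>2 \<le> l"
      by (simp add: l_def linear_scale[OF lin] power2_eq_square)
    then show ?thesis
      using False by (simp add: divide_le_eq dot_square_norm)
  qed (simp add: linear_0[OF lin])
  \<comment> \<open>The residual of the eigenvalue equation, which is orthogonal to
    \<open>v\<close>. The rest of the proof shows that it vanishes.\<close>
  define w where "w = f v - l *\<^sub>R v"
  have wV: "w \<in> V"
    unfolding w_def using inv vV V by (auto intro!: subspace_diff subspace_scale)
  have vw: "v \<bullet> w = 0"
    by (simp add: w_def inner_diff_right vv l_def)
  have vfw: "v \<bullet> f w = w \<bullet> w"
  proof -
    have "v \<bullet> f w = f v \<bullet> w" by (simp add: adj)
    also have "f v = w + l *\<^sub>R v" by (simp add: w_def)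
    finally show ?thesis by (simp add: inner_add_left vw)
  qed
  \<comment> \<open>First variation of the Rayleigh quotient at the maximizer v in the direction w.\<close>
  have var: "2 * t * (w \<bullet> w) \<le> t\<^sup>2 * (l * (w \<bullet> w) - w \<bullet> f w)" for t
  proof -
    have "(v + t *\<^sub>R w) \<bullet> f (v + t *\<^sub>R w) = l + 2 * t * (w \<bullet> w) + t\<^sup>2 * (w \<bullet> f w)"
      using vfw adj[of v w]
      by (simp add: linear_add[OF lin] linear_scale[OF lin] inner_add_left inner_add_right
          l_def power2_eq_square inner_commute[of w "f v"] algebra_simps)
    moreover have "(v + t *\<^sub>R w) \<bullet> (v + t *\<^sub>R w) = 1 + t\<^sup>2 * (w \<bullet> w)"
      by (simp add: inner_add_left inner_add_right vv vw inner_commute[of w v] power2_eq_square)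
    moreover have "v + t *\<^sub>R w \<in> V"
      using vV wV V by (simp add: subspace_add subspace_scale)
    ultimately show ?thesis
      using q[of "v + t *\<^sub>R w"] by (simp add: algebra_simps)
  qed
  have "w \<bullet> w \<le> 0"
  proof (rule ccontr)
    assume "\<not> w \<bullet> w \<le> 0"
    then have a: "w \<bullet> w > 0" by (simp only: not_le)
    \<comment> \<open>\<open>c\<close> dominates the second-order coefficient in \<open>var\<close>,
      and the summand 1 keeps it positive. With \<open>t * c = w \<bullet> w\<close>, the
      first-order term wins and \<open>2 * (w \<bullet> w) \<le> w \<bullet> w\<close>
      results.\<close>
    define c where "c = \<bar>l * (w \<bullet> w) - w \<bullet> f w\<bar> + 1"
    define t where "t = (w \<bullet> w) / c"
    have c: "c > 0" by (simp add: c_def)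
    then have t: "t > 0" using a by (simp add: t_def)
    have "2 * t * (w \<bullet> w) \<le> t\<^sup>2 * c"
      by (rule order_trans[OF var[of t]]) (simp add: c_def mult_left_mono)
    then have "2 * (w \<bullet> w) \<le> t * c"
      using t by (simp add: power2_eq_square mult.assoc)
    then show False using a c by (simp add: t_def)
  qed
  then have "w = 0"
    by (metis inner_gt_zero_iff not_le)
  then have "f v = l *\<^sub>R v"
    by (simp add: w_def)
  with that vV v show thesis by auto
qed

text \<open>Induction on the dimension: split off a unit eigenvector \<open>v\<close>. By
  self-adjointness its orthogonal complement inside \<open>V\<close> is again invariant, and it has
  dimension one less.\<close>

lemma self_adjoint_orthonormal_eigenbasis:
  fixes f :: "'a::euclidean_space \<Rightarrow> 'a"
  assumes lin: "linear f" and adj: "\<And>x y. f x \<bullet> y = x \<bullet> f y"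
    and "subspace V" and "f ` V \<subseteq> V"
  shows "\<exists>B. pairwise orthogonal B \<and> card B = dim V \<and> finite B \<and> B \<subseteq> V \<and>
    (\<forall>b\<in>B. norm b = 1 \<and> (\<exists>l. f b = l *\<^sub>R b))"
  using assms(3,4)
proof (induction "dim V" arbitrary: V)
  case 0
  then show ?case by (intro exI[of _ "{}"]) auto
next
  case (Suc k)
  then have "V \<noteq> {0}" by auto
  then obtain v l where v: "v \<in> V" "norm v = 1" "f v = l *\<^sub>R v"
    using self_adjoint_eigenvector_in_subspace[OF lin adj Suc.prems] by blast
  let ?W = "{x. x \<in> V \<and> orthogonal v x}"
  have W: "subspace ?W"
    using Suc.prems(1) by (auto simp: subspace_def orthogonal_def inner_add_right)
  have "orthogonal v (f x)" if "orthogonal v x" for x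
  proof -
    have "v \<bullet> f x = f v \<bullet> x" by (simp add: adj)
    then show ?thesis using that v(3) by (simp add: orthogonal_def)
  qed
  then have invW: "f ` ?W \<subseteq> ?W"
    using Suc.prems(2) by auto
  have dimW: "dim ?W + 1 = dim V"
  proof -
    have "dim {y \<in> V. \<forall>x \<in> {v}. orthogonal x y} + dim {v} = dim V"
    proof -
      have "dim {y \<in> V. \<forall>x \<in> span {v}. orthogonal x y} + dim (span {v}) = dim V"
        using v(1) Suc.prems(1)
        by (intro dim_subspace_orthogonal_to_vectors) (simp_all add: span_minimal)
      \<comment> \<open>The dimension formula is about the subspace \<open>span {v}\<close>;
        orthogonality to the span is tested on the generator, recovered as the multiple with scalar
        1.\<close>
      moreover have "(\<forall>x \<in> span {v}. orthogonal x y) \<longleftrightarrow> orthogonal v y" for y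
        by (auto simp: span_singleton orthogonal_def dest: spec[of _ "1::real"])
      ultimately show ?thesis by simp
    qed
    moreover have "v \<noteq> 0" using v(2) by auto
    ultimately show ?thesis by (simp add: dim_singleton)
  qed
  obtain B where B: "pairwise orthogonal B" "card B = dim ?W" "finite B" "B \<subseteq> ?W"
    "\<forall>b\<in>B. norm b = 1 \<and> (\<exists>l. f b = l *\<^sub>R b)"
    using Suc.hyps(1)[OF _ W invW] dimW Suc.hyps(2) by auto
  have "v \<notin> B"
    using B(4) v(2) by (auto simp: orthogonal_self)
  moreover have "pairwise orthogonal (insert v B)"
    using B(1,4) by (auto simp: pairwise_insert orthogonal_commute)
  ultimately show ?case
    using B v dimW by (intro exI[of _ "insert v B"]) auto
qed

text \<open>The orthonormal eigenbasis has as many vectors as there are indices, so a bijection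
  \<open>g\<close> makes its elements the columns of \<open>Q\<close>, with the eigenvalues on the
  diagonal of \<open>L\<close>.\<close>

lemma symmetric_matrix_orthogonally_diagonalizable:
  fixes S :: "real ^ 'n ^ 'n"
  assumes "transpose S = S"
  obtains Q L where "orthogonal_matrix Q" "diagonal_matrix L" "S ** Q = Q ** L"
proof -
  have adj: "(S *v x) \<bullet> y = x \<bullet> (S *v y)" for x y
    using dot_lmul_matrix[of x S y] transpose_matrix_vector[of S x] assms by simp
  obtain B :: "(real ^ 'n) set" where
    B: "pairwise orthogonal B" "card B = CARD('n)" "finite B"
    and eig: "\<And>b. b \<in> B \<Longrightarrow> norm b = 1 \<and> (\<exists>l. S *v b = l *\<^sub>R b)"
    using self_adjoint_orthonormal_eigenbasis[of "(*v) S" UNIV, OF matrix_vector_mul_linear adj]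
    by auto
  obtain g where g: "bij_betw g (UNIV :: 'n set) B"
    using finite_same_card_bij[of "UNIV :: 'n set" B] B by auto
  then have gB: "g i \<in> B" for i by (auto simp: bij_betw_def)
  obtain l where l: "\<And>i. S *v g i = l i *\<^sub>R g i"
  proof -
    have "\<forall>i. \<exists>l. S *v g i = l *\<^sub>R g i" using eig gB by blast
    then show thesis using that by metis
  qed
  define Q :: "real ^ 'n ^ 'n" where "Q = (\<chi> i j. g j $ i)"
  define L :: "real ^ 'n ^ 'n" where "L = (\<chi> i j. if i = j then l j else 0)"
  have "g i \<bullet> g j = (if i = j then 1 else 0)" for i j
  proof (cases "i = j")
    case True
    then show ?thesis using eig[OF gB] by (simp add: dot_square_norm)
  next
    case False
    then have "g i \<noteq> g j" using g by (auto simp: bij_betw_def inj_on_def)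
    then show ?thesis using B(1) gB False by (auto simp: pairwise_def orthogonal_def)
  qed
  then have "transpose Q ** Q = mat 1"
    by (simp add: Q_def transpose_def matrix_matrix_mult_def mat_def vec_eq_iff inner_vec_def)
  then have "orthogonal_matrix Q"
    by (simp add: orthogonal_matrix)
  moreover have "diagonal_matrix L"
    by (simp add: L_def diagonal_matrix_def)
  moreover have "S ** Q = Q ** L"
  proof -
    have "(S ** Q) $ i $ j = (Q ** L) $ i $ j" for i j
    proof -
      have "(S ** Q) $ i $ j = (S *v g j) $ i"
        by (simp add: Q_def matrix_matrix_mult_def matrix_vector_mult_def)
      also have "\<dots> = (Q ** L) $ i $ j"
        by (simp add: l Q_def L_def matrix_matrix_mult_def if_distrib cong: if_cong)
      finally show ?thesis .
    qed
    then show ?thesis by (simp add: vec_eq_iff)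
  qed
  ultimately show thesis using that by blast
qed

section \<open>Diagonalizability through similarity to a symmetric matrix\<close>

lemma matrix_mult_matrix_inv_right:
  fixes A :: "'a::semiring_1 ^ 'n ^ 'm"
  assumes "invertible A"
  shows "A ** matrix_inv A = mat 1"
  using someI_ex[OF assms[unfolded invertible_def]] by (simp add: matrix_inv_def)

text \<open>If \<open>Q\<close> diagonalizes the symmetric matrix \<open>E K E\<close>, then
  \<open>P = E Q\<close> diagonalizes \<open>E E K\<close>, because
  \<open>(E E K) E = E (E K E)\<close>.\<close>

lemma diagonalizable_square_times_symmetric:
  fixes E K :: "real ^ 'n ^ 'n"
  assumes symK: "transpose K = K" and symE: "transpose E = E" and invE: "invertible E"
  shows "diagonalizable (E ** E ** K)"
proof -
  have "transpose (E ** K ** E) = E ** K ** E"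
    by (simp add: matrix_transpose_mul symK symE matrix_mul_assoc)
  then obtain Q L where Q: "orthogonal_matrix Q" and L: "diagonal_matrix L"
    and QL: "(E ** K ** E) ** Q = Q ** L"
    using symmetric_matrix_orthogonally_diagonalizable by blast
  define P where "P = E ** Q"
  have invP: "invertible P"
    unfolding P_def using Q invE
    by (metis invertible_mult invertible_def orthogonal_matrix_def)
  have "(E ** E ** K) ** P = E ** ((E ** K ** E) ** Q)"
    by (simp add: P_def matrix_mul_assoc)
  also have "\<dots> = P ** L"
    by (simp add: QL P_def matrix_mul_assoc)
  finally have "(E ** E ** K) ** P ** matrix_inv P = P ** L ** matrix_inv P"
    by simp
  moreover have "(E ** E ** K) ** P ** matrix_inv P = E ** E ** K"
    by (metis matrix_mult_matrix_inv_right invP matrix_mul_assoc matrix_mul_rid)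
  ultimately show ?thesis
    unfolding diagonalizable_def using invP L by metis
qed

section \<open>Diagonal matrices and bounds on the quadratic form of the kernel matrix\<close>

lemma diagonal_matrices_mult:
  fixes a b :: "'n::finite \<Rightarrow> 'a::semiring_1"
  shows "(\<chi> i j. if i = j then a i else 0) ** (\<chi> i j. if i = j then b i else 0)
    = (\<chi> i j. if i = j then a i * b i else 0)"
  by (simp add: matrix_matrix_mult_def vec_eq_iff if_distrib[of "\<lambda>z. z * _"] cong: if_cong)

text \<open>Positive definiteness speaks of points numbered by naturals; an enumeration
  \<open>h\<close> of the finite index type transfers it to vectors.\<close>

lemma positive_definite_kernel_matrix_quadratic_form:
  fixes \<xi> :: "'n::finite \<Rightarrow> 'a"
  assumes "positive_definite_kernel \<phi>"
  shows "v \<bullet> (kernel_matrix \<phi> \<xi> *v v) \<ge> 0"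
proof -
  obtain h where h: "bij_betw h {..<CARD('n)} (UNIV :: 'n set)"
    using ex_bij_betw_nat_finite[of "UNIV :: 'n set"] by (auto simp: atLeast0LessThan)
  have "v \<bullet> (kernel_matrix \<phi> \<xi> *v v) = (\<Sum>i\<in>UNIV. \<Sum>j\<in>UNIV. v $ i * v $ j * \<phi> (\<xi> i) (\<xi> j))"
    by (simp add: inner_vec_def matrix_vector_mult_def kernel_matrix_def sum_distrib_left mult_ac)
  also have "\<dots> = (\<Sum>i<CARD('n). \<Sum>j\<in>UNIV. v $ h i * v $ j * \<phi> (\<xi> (h i)) (\<xi> j))"
    by (rule sum.reindex_bij_betw[OF h, symmetric])
  also have "\<dots> = (\<Sum>i<CARD('n). \<Sum>j<CARD('n). v $ h i * v $ h j * \<phi> (\<xi> (h i)) (\<xi> (h j)))"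
    by (intro sum.cong refl sum.reindex_bij_betw[OF h, symmetric])
  also have "\<dots> \<ge> 0"
    using assms[unfolded positive_definite_kernel_def, rule_format, of "CARD('n)" "\<lambda>i. v $ h i" "\<lambda>i. \<xi> (h i)"]
    by (simp add: Suc_le_eq)
  finally show ?thesis .
qed

lemma row_sum_matrix_mult_vec:
  "row_sum_matrix K *v x = (\<chi> i. row_sum_matrix K $ i $ i * x $ i)"
  unfolding row_sum_matrix_def
  by (simp add: matrix_vector_mult_def vec_eq_iff if_distrib[of "\<lambda>z. z * _"] cong: if_cong)

lemma quadratic_form_le_row_sum_matrix:
  fixes K :: "real ^ 'n ^ 'n"
  assumes nonneg: "\<And>i j. K $ i $ j \<ge> 0" and sym: "transpose K = K"
  shows "v \<bullet> (K *v v) \<le> v \<bullet> (row_sum_matrix K *v v)"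
proof -
  have symij: "K $ i $ j = K $ j $ i" for i j
    using sym by (metis transpose_def vec_lambda_beta)
  have K: "v \<bullet> (K *v v) = (\<Sum>i\<in>UNIV. \<Sum>j\<in>UNIV. K $ i $ j * v $ i * v $ j)"
    by (simp add: inner_vec_def matrix_vector_mult_def sum_distrib_left mult_ac)
  have R: "v \<bullet> (row_sum_matrix K *v v) = (\<Sum>i\<in>UNIV. \<Sum>j\<in>UNIV. K $ i $ j * (v $ i)\<^sup>2)"
    unfolding row_sum_matrix_mult_vec
    by (simp add: row_sum_matrix_def inner_vec_def sum_distrib_left sum_distrib_right
        power2_eq_square mult_ac)
  also have "\<dots> = (\<Sum>j\<in>UNIV. \<Sum>i\<in>UNIV. K $ i $ j * (v $ i)\<^sup>2)"
    by (rule sum.swap)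
  \<comment> \<open>By symmetry of \<open>K\<close>, row sums and column sums agree. Adding
    \<open>R\<close> and \<open>R'\<close> supplies both squares in the expansion of
    \<open>(v $ i - v $ j)\<^sup>2\<close>.\<close>
  finally have R': "v \<bullet> (row_sum_matrix K *v v) = (\<Sum>i\<in>UNIV. \<Sum>j\<in>UNIV. K $ i $ j * (v $ j)\<^sup>2)"
    by (subst (asm) symij) simp
  have "0 \<le> (\<Sum>i\<in>UNIV. \<Sum>j\<in>UNIV. K $ i $ j * (v $ i - v $ j)\<^sup>2)"
    by (intro sum_nonneg mult_nonneg_nonneg nonneg) auto
  also have "\<dots> = v \<bullet> (row_sum_matrix K *v v) + v \<bullet> (row_sum_matrix K *v v) - 2 * (v \<bullet> (K *v v))"
    by (subst R, subst R', subst K)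
      (simp add: power2_diff algebra_simps sum.distrib sum_subtractf sum_distrib_left)
  finally show ?thesis by simp
qed

section \<open>Averagedness of self-adjoint operators between 0 and the identity\<close>

lemma averaged_if_quadratic_form_bounds:
  fixes ip :: "'v::real_vector \<Rightarrow> 'v \<Rightarrow> real"
  assumes ip: "is_inner_product ip" and lin: "linear A"
    and adj: "\<And>x y. ip (A x) y = ip x (A y)"
    and ge: "\<And>x. ip (A x) x \<ge> 0" and le: "\<And>x. ip (A x) x \<le> ip x x"
    and \<theta>: "\<theta> \<in> {1/2..<1}"
  shows "averaged ip \<theta> A"
proof -
  have comm: "ip x y = ip y x" and addl: "ip (x + y) z = ip x z + ip y z"
    and scl: "ip (r *\<^sub>R x) y = r * ip x y" for x y z r
    using ip by (auto simp: is_inner_product_def)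
  have addr: "ip z (x + y) = ip z x + ip z y" and scr: "ip y (r *\<^sub>R x) = r * ip y x" for x y z r
    using comm addl scl by metis+
  have diffl: "ip (x - y) z = ip x z - ip y z" for x y z
    using addl[of "x - y" y z] by simp
  have diffr: "ip z (x - y) = ip z x - ip z y" for x y z
    using diffl comm by metis
  \<comment> \<open>A - A^2 = (I - A) A (I - A) + A (I - A) A is a sum of two positive operators.\<close>
  have sq: "ip (A x) (A x) \<le> ip (A x) x" for x
  proof -
    have "0 \<le> ip (A (x - A x)) (x - A x) + (ip (A x) (A x) - ip (A (A x)) (A x))"
      using ge[of "x - A x"] le[of "A x"] by simp
    also have "\<dots> = ip (A x) x - ip (A x) (A x)"
      by (simp add: linear_diff[OF lin] diffl diffr adj)
    finally show ?thesis by simp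
  qed
  \<comment> \<open>The only possible choice, obtained by solving
    \<open>A = (1 - \<theta>) I + \<theta> T\<close> for \<open>T\<close>.\<close>
  define T where "T x = (1 / \<theta>) *\<^sub>R (A x - (1 - \<theta>) *\<^sub>R x)" for x
  have \<theta>0: "\<theta> > 0" using \<theta> by auto
  have bnd: "ip (T x) (T x) \<le> ip x x" for x
  proof -
    have "ip (A x - (1 - \<theta>) *\<^sub>R x) (A x - (1 - \<theta>) *\<^sub>R x)
        = ip (A x) (A x) - 2 * (1 - \<theta>) * ip (A x) x + (1 - \<theta>)\<^sup>2 * ip x x"
    proof -
      have "ip (A x - a *\<^sub>R x) (A x - a *\<^sub>R x)
          = ip (A x) (A x) - 2 * a * ip (A x) x + a\<^sup>2 * ip x x" for a
        by (simp add: diffl diffr scl scr comm[of x "A x"] power2_eq_square right_diff_distrib)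
      then show ?thesis .
    qed
    also have "\<dots> \<le> (2 * \<theta> - 1) * ip (A x) x + (1 - \<theta>)\<^sup>2 * ip x x"
      using sq[of x] by (simp add: algebra_simps)
    \<comment> \<open>Here \<theta> \<ge> 1/2 enters: the factor \<open>2 * \<theta> - 1\<close>
      must be nonnegative. The coefficients then add up to \<open>\<theta>\<^sup>2\<close>, which
      cancels the scaling in \<open>T\<close>.\<close>
    also have "\<dots> \<le> (2 * \<theta> - 1) * ip x x + (1 - \<theta>)\<^sup>2 * ip x x"
      using \<theta> le[of x] by (intro add_right_mono mult_left_mono) auto
    also have "\<dots> = \<theta>\<^sup>2 * ip x x"
      by (simp add: power2_eq_square algebra_simps)
    finally show ?thesis
      using \<theta>0 by (simp add: T_def scl scr divide_le_eq power2_eq_square mult_ac)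
  qed
  have "T x - T y = T (x - y)" for x y
    by (simp add: T_def linear_diff[OF lin] algebra_simps)
  then have "induced_norm ip (T x - T y) \<le> induced_norm ip (x - y)" for x y
    using bnd by (simp add: induced_norm_def)
  moreover have "A x = (1 - \<theta>) *\<^sub>R x + \<theta> *\<^sub>R T x" for x
    using \<theta>0 by (simp add: T_def)
  ultimately show ?thesis
    unfolding averaged_def using ip \<theta> by auto
qed

theorem mainTheorem7:
  fixes \<phi> :: "real ^ 'm \<Rightarrow> real ^ 'm \<Rightarrow> real"
    and \<xi> :: "'n::finite \<Rightarrow> real ^ 'm"
    and K Dm :: "real ^ 'n ^ 'n"
    and D :: "real ^ 'n \<Rightarrow> real ^ 'n"
  assumes nonneg: "\<And>x y. \<phi> x y \<ge> 0"
    and sym: "\<And>x y. \<phi> x y = \<phi> y x"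
    and K_def: "K = kernel_matrix \<phi> \<xi>"
    and Dm_def: "Dm = row_sum_matrix K"
    and Dm_pos: "\<And>i. Dm $ i $ i > 0"
    and pd: "positive_definite_kernel \<phi>"
    and D_def: "D = (\<lambda>x. (matrix_inv Dm ** K) *v x)"
  shows "D \<in> class_L \<and>
         diagonalizable (matrix_inv Dm ** K) \<and>
         (\<forall>l. eigenvalue (matrix_inv Dm ** K) l \<longrightarrow> l \<in> {0..1}) \<and>
         (\<forall>\<theta>\<in>{1/2..<1}. averaged (\<lambda>x y. x \<bullet> (Dm *v y)) \<theta> D)"
proof -
  let ?A = "matrix_inv Dm ** K"
  have symK: "transpose K = K"
    using sym by (simp add: K_def kernel_matrix_def transpose_def vec_eq_iff)
  have adjK: "(K *v x) \<bullet> y = x \<bullet> (K *v y)" for x y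
    using dot_lmul_matrix[of x K y] transpose_matrix_vector[of K x] symK by simp
  have K_ge: "v \<bullet> (K *v v) \<ge> 0" for v
    unfolding K_def by (rule positive_definite_kernel_matrix_quadratic_form[OF pd])
  have K_le: "v \<bullet> (K *v v) \<le> v \<bullet> (Dm *v v)" for v
    unfolding Dm_def
    by (rule quadratic_form_le_row_sum_matrix[OF _ symK]) (simp add: K_def kernel_matrix_def nonneg)
  have Dm_vec: "Dm *v x = (\<chi> i. Dm $ i $ i * x $ i)" for x
    unfolding Dm_def by (rule row_sum_matrix_mult_vec)
  define d where "d i = Dm $ i $ i" for i
  have d_pos: "d i > 0" for i using Dm_pos by (simp add: d_def)
  have Dm_diag: "Dm = (\<chi> i j. if i = j then d i else 0)"
    by (simp add: d_def Dm_def row_sum_matrix_def vec_eq_iff)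
  define E :: "real ^ 'n ^ 'n" where "E = (\<chi> i j. if i = j then 1 / sqrt (d i) else 0)"
  have "1 / sqrt (d i) * (1 / sqrt (d i)) * d i = 1" for i
    using d_pos[of i] by simp
  then have EED: "E ** E ** Dm = mat 1"
    unfolding E_def Dm_diag diagonal_matrices_mult by (simp only: mat_def)
  have inv: "invertible Dm"
    using EED invertible_left_inverse by blast
  have Dinv: "matrix_inv Dm = E ** E"
    by (metis EED inv matrix_mult_matrix_inv_right matrix_mul_assoc matrix_mul_lid matrix_mul_rid)
  have "E ** (E ** Dm) = mat 1"
    using EED by (simp add: matrix_mul_assoc)
  then have invE: "invertible E"
    using invertible_right_inverse by blast
  have "transpose E = E"
    by (simp add: E_def transpose_def vec_eq_iff)
  then have diag: "diagonalizable ?A"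
    unfolding Dinv using diagonalizable_square_times_symmetric[OF symK _ invE] by simp
  \<comment> \<open>Clearing the inverse: statements about the filter in the \<open>Dm\<close> inner
    product become statements about \<open>K\<close>.\<close>
  have DA: "Dm *v (?A *v x) = K *v x" for x
    by (metis inv matrix_mult_matrix_inv_right matrix_mul_assoc matrix_mul_lid matrix_vector_mul_assoc)

  have ip: "is_inner_product (\<lambda>x y. x \<bullet> (Dm *v y))"
    unfolding is_inner_product_def
  proof (intro conjI allI impI)
    fix x y :: "real ^ 'n"
    show "x \<bullet> (Dm *v y) = y \<bullet> (Dm *v x)"
      by (simp add: Dm_vec inner_vec_def mult_ac)
  next
    fix x :: "real ^ 'n" assume "x \<noteq> 0"
    then obtain i where i: "x $ i \<noteq> 0" by (auto simp: vec_eq_iff)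
    have "0 < (\<Sum>i\<in>UNIV. Dm $ i $ i * (x $ i)\<^sup>2)"
      by (rule sum_pos2[of _ i]) (use i Dm_pos in \<open>auto simp: less_imp_le\<close>)
    then show "0 < x \<bullet> (Dm *v x)"
      by (simp add: Dm_vec inner_vec_def power2_eq_square mult_ac)
  qed (simp_all add: inner_add_left)

  have eig: "l \<in> {0..1}" if "eigenvalue ?A l" for l
  proof -
    obtain v where v: "v \<noteq> 0" "?A *v v = l *\<^sub>R v"
      using \<open>eigenvalue ?A l\<close> by (auto simp: eigenvalue_def)
    \<comment> \<open>The eigenvalue equation as a generalized one for the pair \<open>K\<close>,
      \<open>Dm\<close>. Pairing with \<open>v\<close> traps \<open>l\<close> times a positive
      number between 0 and that number.\<close>
    have "K *v v = l *\<^sub>R (Dm *v v)"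
      using DA[of v] v(2) by (simp add: matrix_vector_mult_scaleR)
    then have "0 \<le> l * (v \<bullet> (Dm *v v))" "l * (v \<bullet> (Dm *v v)) \<le> v \<bullet> (Dm *v v)"
      using K_ge[of v] K_le[of v] by simp_all
    moreover have "v \<bullet> (Dm *v v) > 0"
      using ip v(1) by (simp add: is_inner_product_def)
    ultimately show ?thesis
      by (simp add: zero_le_mult_iff)
  qed

  \<comment> \<open>In the \<open>Dm\<close> inner product the bilinear form of \<open>D\<close> is
    that of \<open>K\<close>, so self-adjointness and both bounds carry over from
    \<open>K\<close>.\<close>
  have ipD: "D x \<bullet> (Dm *v y) = x \<bullet> (K *v y)" for x y
  proof -
    have "D x \<bullet> (Dm *v y) = y \<bullet> (Dm *v D x)"
      using ip unfolding is_inner_product_def by blast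
    also have "\<dots> = (K *v x) \<bullet> y"
      by (simp add: D_def DA inner_commute)
    also have "\<dots> = x \<bullet> (K *v y)"
      by (rule adjK)
    finally show ?thesis .
  qed
  have avg: "averaged (\<lambda>x y. x \<bullet> (Dm *v y)) \<theta> D" if "\<theta> \<in> {1/2..<1}" for \<theta>
  proof (rule averaged_if_quadratic_form_bounds[OF ip _ _ _ _ that])
    show "linear D" by (simp add: D_def matrix_vector_mul_linear)
    show "D x \<bullet> (Dm *v y) = x \<bullet> (Dm *v D y)" for x y
      unfolding ipD by (simp add: D_def DA)
  qed (simp_all add: ipD K_ge K_le)
  have "D \<in> class_L"
    unfolding class_L_def using D_def diag eig by blast
  then show ?thesis
    using diag eig avg by blast
qed

end
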